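(* Let $\mathcal{D}$ be a small category. For every $n\in\mathbb{N}$, the interpretation of $\mathrm{IBD}_n$ in $\widehat{\mathcal{D}}$ determines the sieve on $\mathcal{D}$ consisting of the objects $D$ such that, in every sequence $$\cdot \to \cdot \to \cdots \to \cdot \to D$$ of $n+1$ (composable) maps in $\mathcal{D}$, one of the maps is an isomorphism.
   Context: $\mathbb{N}$ includes $0$. $\widehat{\mathcal{D}}$ denotes the topos of presheaves on $\mathcal{D}$. Subterminal objects of $\widehat{\mathcal{D}}$ correspond to sieves on $\mathcal{D}$, i.e. subsets $U$ of objects of $\mathcal{D}$ such that for every map $E\to D$ in $\mathcal{D}$, if $D\in U$ then $E\in U$ (the subterminal $U\to 1$ corresponds to the set of objects $D$ with $UD\neq\emptyset$). In the internal language of a topos with subobject classifier $\Omega$, define the closed formulas $\mathrm{IBD}_{-\infty} := \bot$, $\mathrm{IBD}_0 := (\forall x:\Omega)(x \vee (x\Rightarrow \mathrm{IBD}_{-\infty}))$, and $\mathrm{IBD}_{n+1} := (\forall x:\Omega)(x \vee (x \Rightarrow \mathrm{IBD}_n))$ for $n\in\mathbb{N}$. The interpretation of each of these in a topos is a subterminal object. *)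

theory Defs
  imports Main
begin

section \<open>Small categories\<close>

record ('o, 'a) cat =
  Ob :: "'o set"
  Ar :: "'a set"
  src :: "'a \<Rightarrow> 'o"
  tgt :: "'a \<Rightarrow> 'o"
  idt :: "'o \<Rightarrow> 'a"
  cmp :: "'a \<Rightarrow> 'a \<Rightarrow> 'a"

text \<open>Composition is in applicative order: \<open>cmp C g f\<close> is ``\<open>g\<close> after \<open>f\<close>'', and is only
  meaningful when \<open>src C g = tgt C f\<close>. Objects and arrows form sets, so the category is small;
  it may be empty.\<close>

locale small_category =
  fixes C :: "('o, 'a) cat"
  assumes src_Ob: "f \<in> Ar C \<Longrightarrow> src C f \<in> Ob C"
    and tgt_Ob: "f \<in> Ar C \<Longrightarrow> tgt C f \<in> Ob C"
    and idt_Ar: "D \<in> Ob C \<Longrightarrow> idt C D \<in> Ar C"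
    and src_idt: "D \<in> Ob C \<Longrightarrow> src C (idt C D) = D"
    and tgt_idt: "D \<in> Ob C \<Longrightarrow> tgt C (idt C D) = D"
    and cmp_Ar: "f \<in> Ar C \<Longrightarrow> g \<in> Ar C \<Longrightarrow> src C g = tgt C f \<Longrightarrow> cmp C g f \<in> Ar C"
    and src_cmp: "f \<in> Ar C \<Longrightarrow> g \<in> Ar C \<Longrightarrow> src C g = tgt C f \<Longrightarrow> src C (cmp C g f) = src C f"
    and tgt_cmp: "f \<in> Ar C \<Longrightarrow> g \<in> Ar C \<Longrightarrow> src C g = tgt C f \<Longrightarrow> tgt C (cmp C g f) = tgt C g"
    and cmp_idt_right: "f \<in> Ar C \<Longrightarrow> cmp C f (idt C (src C f)) = f"
    and cmp_idt_left: "f \<in> Ar C \<Longrightarrow> cmp C (idt C (tgt C f)) f = f"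
    and cmp_assoc: "f \<in> Ar C \<Longrightarrow> g \<in> Ar C \<Longrightarrow> h \<in> Ar C \<Longrightarrow>
      src C g = tgt C f \<Longrightarrow> src C h = tgt C g \<Longrightarrow> cmp C h (cmp C g f) = cmp C (cmp C h g) f"

definition is_iso :: "('o, 'a) cat \<Rightarrow> 'a \<Rightarrow> bool" where
  "is_iso C f \<longleftrightarrow> f \<in> Ar C \<and> (\<exists>g\<in>Ar C. src C g = tgt C f \<and> tgt C g = src C f \<and>
     cmp C g f = idt C (src C f) \<and> cmp C f g = idt C (tgt C f))"

text \<open>The list \<open>[f\<^sub>1, \<dots>, f\<^sub>m]\<close> stands for
  \<open>\<cdot> \<rightarrow> \<cdot> \<rightarrow> \<dots> \<rightarrow> \<cdot> \<rightarrow> D\<close> with \<open>f\<^sub>1\<close> applied first.\<close>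

definition composable_to :: "('o, 'a) cat \<Rightarrow> 'o \<Rightarrow> 'a list \<Rightarrow> bool" where
  "composable_to C D fs \<longleftrightarrow> fs \<noteq> [] \<and> set fs \<subseteq> Ar C \<and>
     (\<forall>i. Suc i < length fs \<longrightarrow> tgt C (fs ! i) = src C (fs ! Suc i)) \<and> tgt C (last fs) = D"

definition is_sieve :: "('o, 'a) cat \<Rightarrow> 'o set \<Rightarrow> bool" where
  "is_sieve C U \<longleftrightarrow> U \<subseteq> Ob C \<and> (\<forall>f\<in>Ar C. tgt C f \<in> U \<longrightarrow> src C f \<in> U)"

section \<open>Presheaves and subpresheaves\<close>

record ('o, 'a, 'v) presheaf =
  sec :: "'o \<Rightarrow> 'v set"
  res :: "'a \<Rightarrow> 'v \<Rightarrow> 'v"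

definition is_presheaf :: "('o, 'a) cat \<Rightarrow> ('o, 'a, 'v) presheaf \<Rightarrow> bool" where
  "is_presheaf C P \<longleftrightarrow>
     (\<forall>f\<in>Ar C. \<forall>x\<in>sec P (tgt C f). res P f x \<in> sec P (src C f)) \<and>
     (\<forall>D\<in>Ob C. \<forall>x\<in>sec P D. res P (idt C D) x = x) \<and>
     (\<forall>f\<in>Ar C. \<forall>g\<in>Ar C. src C g = tgt C f \<longrightarrow>
        (\<forall>x\<in>sec P (tgt C g). res P (cmp C g f) x = res P f (res P g x)))"

definition is_nat_trans :: "('o, 'a) cat \<Rightarrow> ('o, 'a, 'v) presheaf \<Rightarrow> ('o, 'a, 'w) presheaf \<Rightarrow>
    ('o \<Rightarrow> 'v \<Rightarrow> 'w) \<Rightarrow> bool" where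
  "is_nat_trans C P Q \<alpha> \<longleftrightarrow>
     (\<forall>D\<in>Ob C. \<forall>x\<in>sec P D. \<alpha> D x \<in> sec Q D) \<and>
     (\<forall>f\<in>Ar C. \<forall>x\<in>sec P (tgt C f). \<alpha> (src C f) (res P f x) = res Q f (\<alpha> (tgt C f) x))"

text \<open>Subobjects are represented by subpresheaves. The value off \<open>Ob C\<close> is normalised to the empty
  set, so that equality and inclusion of subobjects are equality and pointwise inclusion of
  functions.\<close>

definition Sub :: "('o, 'a) cat \<Rightarrow> ('o, 'a, 'v) presheaf \<Rightarrow> ('o \<Rightarrow> 'v set) set" where
  "Sub C P = {A. (\<forall>D\<in>Ob C. A D \<subseteq> sec P D) \<and> (\<forall>D. D \<notin> Ob C \<longrightarrow> A D = {}) \<and>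
     (\<forall>f\<in>Ar C. \<forall>x\<in>A (tgt C f). res P f x \<in> A (src C f))}"

definition pullback :: "('o, 'a) cat \<Rightarrow> ('o, 'a, 'v) presheaf \<Rightarrow> ('o \<Rightarrow> 'v \<Rightarrow> 'w) \<Rightarrow>
    ('o \<Rightarrow> 'w set) \<Rightarrow> ('o \<Rightarrow> 'v set)" where
  "pullback C P \<alpha> A = (\<lambda>D. {x \<in> sec P D. D \<in> Ob C \<and> \<alpha> D x \<in> A D})"

text \<open>Heyting implication in \<open>Sub C P\<close>, and the right adjoint
  \<open>\<forall>\<^sub>\<alpha>\<close> of pulling back along \<open>\<alpha> : P \<rightarrow> Q\<close>: each is the largest subobject with the
  property in question (lemmas \<open>heyting_imp_adjoint\<close>, \<open>forall_along_adjoint\<close>).\<close>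

definition heyting_imp :: "('o, 'a) cat \<Rightarrow> ('o, 'a, 'v) presheaf \<Rightarrow>
    ('o \<Rightarrow> 'v set) \<Rightarrow> ('o \<Rightarrow> 'v set) \<Rightarrow> ('o \<Rightarrow> 'v set)" where
  "heyting_imp C P A B = Sup {X \<in> Sub C P. inf X A \<le> B}"

definition forall_along :: "('o, 'a) cat \<Rightarrow> ('o, 'a, 'v) presheaf \<Rightarrow> ('o, 'a, 'w) presheaf \<Rightarrow>
    ('o \<Rightarrow> 'v \<Rightarrow> 'w) \<Rightarrow> ('o \<Rightarrow> 'v set) \<Rightarrow> ('o \<Rightarrow> 'w set)" where
  "forall_along C P Q \<alpha> A = Sup {X \<in> Sub C Q. pullback C P \<alpha> X \<le> A}"

section \<open>The subobject classifier\<close>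

text \<open>\<open>\<Omega>(D)\<close> consists of the sieves on the object \<open>D\<close> (sets of arrows into \<open>D\<close>).\<close>

definition max_sieve :: "('o, 'a) cat \<Rightarrow> 'o \<Rightarrow> 'a set" where
  "max_sieve C D = {f \<in> Ar C. tgt C f = D}"

definition Omega :: "('o, 'a) cat \<Rightarrow> ('o, 'a, 'a set) presheaf" where
  "Omega C = \<lparr>
     sec = (\<lambda>D. {S. S \<subseteq> max_sieve C D \<and>
       (\<forall>f\<in>S. \<forall>g\<in>Ar C. tgt C g = src C f \<longrightarrow> cmp C f g \<in> S)}),
     res = (\<lambda>f S. {g \<in> Ar C. tgt C g = src C f \<and> cmp C f g \<in> S})\<rparr>"

definition truth :: "('o, 'a) cat \<Rightarrow> ('o \<Rightarrow> 'a set set)" where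
  "truth C = (\<lambda>D. if D \<in> Ob C then {max_sieve C D} else {})"

text \<open>The power \<open>\<Omega>\<^sup>k\<close>, with sections the lists of length \<open>k\<close>; \<open>\<Omega>\<^sup>0\<close> is the terminal presheaf.\<close>

definition Omega_pow :: "('o, 'a) cat \<Rightarrow> nat \<Rightarrow> ('o, 'a, 'a set list) presheaf" where
  "Omega_pow C k = \<lparr>
     sec = (\<lambda>D. {xs. length xs = k \<and> set xs \<subseteq> sec (Omega C) D}),
     res = (\<lambda>f. map (res (Omega C) f))\<rparr>"

section \<open>The internal language\<close>

text \<open>Formulas of the internal language all of whose variables have type \<open>\<Omega>\<close>, with de Bruijn
  indices; \<open>All\<close> is \<open>(\<forall>x:\<Omega>)\<close>. In a context \<open>xs\<close> the variable with index \<open>i\<close> is \<open>xs ! i\<close>.\<close>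

datatype formula = Bot | Var nat | Or formula formula | Imp formula formula | All formula

fun free_below :: "nat \<Rightarrow> formula \<Rightarrow> bool" where
  "free_below k Bot = True"
| "free_below k (Var i) = (i < k)"
| "free_below k (Or \<phi> \<psi>) = (free_below k \<phi> \<and> free_below k \<psi>)"
| "free_below k (Imp \<phi> \<psi>) = (free_below k \<phi> \<and> free_below k \<psi>)"
| "free_below k (All \<phi>) = free_below (Suc k) \<phi>"

text \<open>\<open>interp C k \<phi>\<close> is the interpretation of \<open>\<phi>\<close> as a subobject of \<open>\<Omega>\<^sup>k\<close>.
  Joins of subpresheaves are pointwise unions, and the
  projection \<open>\<Omega>\<^sup>k\<^sup>+\<^sup>1 \<rightarrow> \<Omega>\<^sup>k\<close> that forgets the most recently bound variable is \<open>tl\<close>.\<close>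

fun interp :: "('o, 'a) cat \<Rightarrow> nat \<Rightarrow> formula \<Rightarrow> ('o \<Rightarrow> 'a set list set)" where
  "interp C k Bot = (\<lambda>_. {})"
| "interp C k (Var i) = pullback C (Omega_pow C k) (\<lambda>_ xs. xs ! i) (truth C)"
| "interp C k (Or \<phi> \<psi>) = sup (interp C k \<phi>) (interp C k \<psi>)"
| "interp C k (Imp \<phi> \<psi>) = heyting_imp C (Omega_pow C k) (interp C k \<phi>) (interp C k \<psi>)"
| "interp C k (All \<phi>) =
     forall_along C (Omega_pow C (Suc k)) (Omega_pow C k) (\<lambda>_. tl) (interp C (Suc k) \<phi>)"

definition IBD_minf :: formula where
  "IBD_minf = Bot"

text \<open>No index shift is needed on substituting \<open>IBD n\<close> under the binder, as it is closed.\<close>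

primrec IBD :: "nat \<Rightarrow> formula" where
  "IBD 0 = All (Or (Var 0) (Imp (Var 0) IBD_minf))"
| "IBD (Suc n) = All (Or (Var 0) (Imp (Var 0) (IBD n)))"

definition sieve_of :: "('o, 'a) cat \<Rightarrow> ('o \<Rightarrow> 'v set) \<Rightarrow> 'o set" where
  "sieve_of C U = {D \<in> Ob C. U D \<noteq> {}}"

section \<open>Basic properties\<close>

lemma free_below_mono: "free_below k \<phi> \<Longrightarrow> k \<le> l \<Longrightarrow> free_below l \<phi>"
  by (induction \<phi> arbitrary: k l) auto

lemma IBD_closed: "free_below 0 (IBD n)"
proof (induction n)
  case (Suc n)
  then show ?case by (auto intro: free_below_mono)
qed (simp add: IBD_minf_def)

lemma Sup_in_Sub:
  assumes "\<And>X. X \<in> \<A> \<Longrightarrow> X \<in> Sub C P"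
  shows "Sup \<A> \<in> Sub C P"
  using assms unfolding Sub_def by (fastforce simp: image_iff)

lemma sup_in_Sub: "A \<in> Sub C P \<Longrightarrow> B \<in> Sub C P \<Longrightarrow> sup A B \<in> Sub C P"
  unfolding Sub_def by auto

lemma heyting_imp_in_Sub: "heyting_imp C P A B \<in> Sub C P"
  unfolding heyting_imp_def by (rule Sup_in_Sub) auto

lemma forall_along_in_Sub: "forall_along C P Q \<alpha> A \<in> Sub C Q"
  unfolding forall_along_def by (rule Sup_in_Sub) auto

lemma heyting_imp_adjoint:
  assumes "X \<in> Sub C P"
  shows "X \<le> heyting_imp C P A B \<longleftrightarrow> inf X A \<le> B"
proof
  assume "X \<le> heyting_imp C P A B"
  then show "inf X A \<le> B"
    unfolding heyting_imp_def le_fun_def by (fastforce simp: le_fun_def image_iff)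
next
  assume "inf X A \<le> B"
  with assms show "X \<le> heyting_imp C P A B"
    unfolding heyting_imp_def by (intro Sup_upper) auto
qed

lemma forall_along_adjoint:
  assumes "X \<in> Sub C Q"
  shows "X \<le> forall_along C P Q \<alpha> A \<longleftrightarrow> pullback C P \<alpha> X \<le> A"
proof
  assume le: "X \<le> forall_along C P Q \<alpha> A"
  show "pullback C P \<alpha> X \<le> A"
  proof (rule le_funI, rule subsetI)
    fix D x assume x: "x \<in> pullback C P \<alpha> X D"
    then have "\<alpha> D x \<in> forall_along C P Q \<alpha> A D"
      using le by (auto simp: pullback_def le_fun_def)
    then obtain Y where Y: "Y \<in> Sub C Q" "pullback C P \<alpha> Y \<le> A" "\<alpha> D x \<in> Y D"
      unfolding forall_along_def by auto
    with x have "x \<in> pullback C P \<alpha> Y D"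
      by (auto simp: pullback_def)
    with Y(2) show "x \<in> A D" by (auto simp: le_fun_def)
  qed
next
  assume "pullback C P \<alpha> X \<le> A"
  with assms show "X \<le> forall_along C P Q \<alpha> A"
    unfolding forall_along_def by (intro Sup_upper) auto
qed

context small_category
begin

lemma pullback_in_Sub:
  assumes "is_presheaf C P" "is_nat_trans C P Q \<alpha>" "A \<in> Sub C Q"
  shows "pullback C P \<alpha> A \<in> Sub C P"
  using assms unfolding pullback_def Sub_def is_presheaf_def is_nat_trans_def
  by (auto simp: src_Ob)

lemma max_sieve_in_Omega: "max_sieve C D \<in> sec (Omega C) D"
  by (auto simp: Omega_def max_sieve_def cmp_Ar tgt_cmp)

lemma res_max_sieve:
  "f \<in> Ar C \<Longrightarrow> res (Omega C) f (max_sieve C (tgt C f)) = max_sieve C (src C f)"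
  by (auto simp: Omega_def max_sieve_def cmp_Ar tgt_cmp)

lemma is_presheaf_Omega: "is_presheaf C (Omega C)"
  unfolding is_presheaf_def
proof (intro conjI ballI impI)
  fix f S assume "f \<in> Ar C" "S \<in> sec (Omega C) (tgt C f)"
  then show "res (Omega C) f S \<in> sec (Omega C) (src C f)"
    by (auto simp: Omega_def max_sieve_def cmp_Ar tgt_cmp src_cmp cmp_assoc)
next
  fix D S assume D: "D \<in> Ob C" and S: "S \<in> sec (Omega C) D"
  have "g \<in> Ar C \<and> tgt C g = D \<and> cmp C (idt C D) g \<in> S \<longleftrightarrow> g \<in> S" for g
  proof (cases "g \<in> Ar C \<and> tgt C g = D")
    case True
    then show ?thesis using cmp_idt_left[of g] by simp
  next
    case False
    then show ?thesis using S by (auto simp: Omega_def max_sieve_def)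
  qed
  then show "res (Omega C) (idt C D) S = S"
    using D by (simp add: Omega_def src_idt)
next
  fix f g S assume fg: "f \<in> Ar C" "g \<in> Ar C" "src C g = tgt C f"
  have "cmp C (cmp C g f) h = cmp C g (cmp C f h) \<and> cmp C f h \<in> Ar C \<and> tgt C (cmp C f h) = tgt C f"
    if "h \<in> Ar C" "tgt C h = src C f" for h
    using fg that cmp_assoc[of h f g] cmp_Ar[of h f] tgt_cmp[of h f] by simp
  then show "res (Omega C) (cmp C g f) S = res (Omega C) f (res (Omega C) g S)"
    using fg by (auto simp: Omega_def src_cmp)
qed

lemma truth_in_Sub: "truth C \<in> Sub C (Omega C)"
  using max_sieve_in_Omega res_max_sieve
  by (auto simp: Sub_def truth_def src_Ob tgt_Ob)

text \<open>Uniqueness is up to the junk values of \<open>\<chi>\<close> outside the sections of \<open>P\<close>.\<close>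

lemma Omega_classifies:
  assumes P: "is_presheaf C P" and A: "A \<in> Sub C P"
  shows "\<exists>\<chi>. is_nat_trans C P (Omega C) \<chi> \<and> pullback C P \<chi> (truth C) = A \<and>
    (\<forall>\<chi>'. is_nat_trans C P (Omega C) \<chi>' \<and> pullback C P \<chi>' (truth C) = A \<longrightarrow>
      (\<forall>D\<in>Ob C. \<forall>x\<in>sec P D. \<chi>' D x = \<chi> D x))"
proof -
  define \<chi> where "\<chi> = (\<lambda>D x. {f \<in> Ar C. tgt C f = D \<and> res P f x \<in> A (src C f)})"
  have res_sec: "res P f x \<in> sec P (src C f)" if "f \<in> Ar C" "x \<in> sec P (tgt C f)" for f x
    using P that by (auto simp: is_presheaf_def)
  have res_cmp: "res P (cmp C g f) x = res P f (res P g x)"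
    if "f \<in> Ar C" "g \<in> Ar C" "src C g = tgt C f" "x \<in> sec P (tgt C g)" for f g x
    using P that by (auto simp: is_presheaf_def)
  have res_idt: "res P (idt C D) x = x" if "D \<in> Ob C" "x \<in> sec P D" for D x
    using P that by (auto simp: is_presheaf_def)
  have A_res: "res P f x \<in> A (src C f)" if "f \<in> Ar C" "x \<in> A (tgt C f)" for f x
    using A that by (auto simp: Sub_def)
  have A_sec: "A D \<subseteq> sec P D" if "D \<in> Ob C" for D
    using A that by (auto simp: Sub_def)
  have max_iff: "\<chi> D x = max_sieve C D \<longleftrightarrow> x \<in> A D" if D: "D \<in> Ob C" "x \<in> sec P D" for D x
  proof
    assume "\<chi> D x = max_sieve C D"
    moreover have "idt C D \<in> max_sieve C D"
      using D by (auto simp: max_sieve_def idt_Ar tgt_idt)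
    ultimately have "idt C D \<in> \<chi> D x" by simp
    then show "x \<in> A D" using D by (simp add: \<chi>_def src_idt res_idt)
  qed (auto simp: \<chi>_def max_sieve_def A_res)
  have "is_nat_trans C P (Omega C) \<chi>"
    unfolding is_nat_trans_def
  proof (intro conjI ballI)
    fix D x assume "D \<in> Ob C" "x \<in> sec P D"
    then show "\<chi> D x \<in> sec (Omega C) D"
      by (auto simp: \<chi>_def Omega_def max_sieve_def cmp_Ar tgt_cmp src_cmp res_cmp)
         (metis A_res)
  next
    fix f x assume "f \<in> Ar C" "x \<in> sec P (tgt C f)"
    then show "\<chi> (src C f) (res P f x) = res (Omega C) f (\<chi> (tgt C f) x)"
      by (auto simp: \<chi>_def Omega_def cmp_Ar tgt_cmp src_cmp res_cmp)
  qed
  moreover have "pullback C P \<chi> (truth C) = A"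
  proof
    fix D show "pullback C P \<chi> (truth C) D = A D"
    proof (cases "D \<in> Ob C")
      case True
      with max_iff A_sec[OF True] show ?thesis by (auto simp: pullback_def truth_def)
    next
      case False
      with A show ?thesis by (simp add: pullback_def Sub_def)
    qed
  qed
  moreover have "\<chi>' D x = \<chi> D x"
    if nt: "is_nat_trans C P (Omega C) \<chi>'" and pb: "pullback C P \<chi>' (truth C) = A"
      and D: "D \<in> Ob C" "x \<in> sec P D" for \<chi>' D x
  proof -
    have iff: "\<chi>' E y = max_sieve C E \<longleftrightarrow> y \<in> A E" if "E \<in> Ob C" "y \<in> sec P E" for E y
      using that unfolding pb[symmetric] by (auto simp: pullback_def truth_def)
    have sub: "\<chi>' D x \<subseteq> max_sieve C D"
      and closed: "\<And>f g. f \<in> \<chi>' D x \<Longrightarrow> g \<in> Ar C \<Longrightarrow> tgt C g = src C f \<Longrightarrow> cmp C f g \<in> \<chi>' D x"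
      using nt D by (auto simp: is_nat_trans_def Omega_def)
    have "f \<in> \<chi>' D x \<longleftrightarrow> res P f x \<in> A (src C f)" if f: "f \<in> Ar C" "tgt C f = D" for f
    proof -
      have eq: "\<chi>' (src C f) (res P f x) = {g \<in> Ar C. tgt C g = src C f \<and> cmp C f g \<in> \<chi>' D x}"
        using nt f D by (auto simp: is_nat_trans_def Omega_def)
      have "f \<in> \<chi>' D x \<longleftrightarrow> \<chi>' (src C f) (res P f x) = max_sieve C (src C f)"
      proof
        assume "f \<in> \<chi>' D x"
        then show "\<chi>' (src C f) (res P f x) = max_sieve C (src C f)"
          unfolding eq using closed by (auto simp: max_sieve_def)
      next
        assume "\<chi>' (src C f) (res P f x) = max_sieve C (src C f)"
        moreover have "idt C (src C f) \<in> max_sieve C (src C f)"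
          using f by (simp add: max_sieve_def idt_Ar tgt_idt src_Ob)
        ultimately have "cmp C f (idt C (src C f)) \<in> \<chi>' D x"
          unfolding eq by blast
        then show "f \<in> \<chi>' D x" using f by (simp add: cmp_idt_right)
      qed
      then show ?thesis using iff res_sec f D src_Ob by metis
    qed
    then show ?thesis using sub by (auto simp: \<chi>_def max_sieve_def)
  qed
  ultimately show ?thesis by blast
qed

lemma is_presheaf_Omega_pow: "is_presheaf C (Omega_pow C k)"
proof -
  note O = is_presheaf_Omega[unfolded is_presheaf_def]
  show ?thesis
    unfolding is_presheaf_def
  proof (intro conjI ballI impI)
    fix f xs assume "f \<in> Ar C" "xs \<in> sec (Omega_pow C k) (tgt C f)"
    then show "res (Omega_pow C k) f xs \<in> sec (Omega_pow C k) (src C f)"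
      using O by (auto simp: Omega_pow_def)
  next
    fix D xs assume "D \<in> Ob C" "xs \<in> sec (Omega_pow C k) D"
    then show "res (Omega_pow C k) (idt C D) xs = xs"
      using O by (auto simp: Omega_pow_def intro!: map_idI)
  next
    fix f g xs assume "f \<in> Ar C" "g \<in> Ar C" "src C g = tgt C f"
      "xs \<in> sec (Omega_pow C k) (tgt C g)"
    then show "res (Omega_pow C k) (cmp C g f) xs
        = res (Omega_pow C k) f (res (Omega_pow C k) g xs)"
      using O by (auto simp: Omega_pow_def)
  qed
qed

lemma is_nat_trans_nth: "i < k \<Longrightarrow> is_nat_trans C (Omega_pow C k) (Omega C) (\<lambda>_ xs. xs ! i)"
  by (auto simp: is_nat_trans_def Omega_pow_def)

lemma is_nat_trans_tl: "is_nat_trans C (Omega_pow C (Suc k)) (Omega_pow C k) (\<lambda>_. tl)"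
  by (auto simp: is_nat_trans_def Omega_pow_def length_Suc_conv)

lemma interp_in_Sub: "free_below k \<phi> \<Longrightarrow> interp C k \<phi> \<in> Sub C (Omega_pow C k)"
proof (induction \<phi> arbitrary: k)
  case Bot
  show ?case by (simp add: Sub_def)
next
  case (Var i)
  then show ?case
    by (auto intro!: pullback_in_Sub is_presheaf_Omega_pow is_nat_trans_nth truth_in_Sub)
qed (simp_all add: sup_in_Sub heyting_imp_in_Sub forall_along_in_Sub)

lemma IBD_subterminal: "interp C 0 (IBD n) \<in> Sub C (Omega_pow C 0)"
  by (rule interp_in_Sub) (rule IBD_closed)

text \<open>Subterminal presheaves correspond to sieves on the category.\<close>

lemma sieve_of_bij: "bij_betw (sieve_of C) (Sub C (Omega_pow C 0)) {U. is_sieve C U}"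
proof (rule bij_betw_byWitness[where f' = "\<lambda>U D. if D \<in> U then {[]} else {}"])
  show "sieve_of C ` Sub C (Omega_pow C 0) \<subseteq> {U. is_sieve C U}"
    by (fastforce simp: Sub_def sieve_of_def is_sieve_def src_Ob)
  show "(\<lambda>U D. if D \<in> U then {[]} else {}) ` {U. is_sieve C U} \<subseteq> Sub C (Omega_pow C 0)"
    by (auto simp: Sub_def is_sieve_def Omega_pow_def split: if_splits)
next
  show "\<forall>A\<in>Sub C (Omega_pow C 0). (\<lambda>D. if D \<in> sieve_of C A then {[]} else {}) = A"
  proof
  fix A assume A: "A \<in> Sub C (Omega_pow C 0)"
  show "(\<lambda>D. if D \<in> sieve_of C A then {[]} else {}) = A"
  proof
    fix D show "(if D \<in> sieve_of C A then {[]} else {}) = A D"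
      using A by (cases "D \<in> Ob C") (auto simp: Sub_def sieve_of_def Omega_pow_def)
  qed
  qed
next
  show "\<forall>U\<in>{U. is_sieve C U}. sieve_of C (\<lambda>D. if D \<in> U then {[]} else {}) = U"
    by (auto simp: sieve_of_def is_sieve_def)
qed

end

end

theory Submission
  imports Defs
begin

text \<open>By Kripke--Joyal, \<open>IBD\<^sub>m\<^sub>+\<^sub>1\<close> holds at \<open>D\<close> iff for all
  \<open>g : E' \<rightarrow> E\<close> and \<open>f : E \<rightarrow> D\<close> the map \<open>g\<close> is a split epimorphism or \<open>IBD\<^sub>m\<close> holds at \<open>E'\<close>
  (test on the sieve generated by \<open>g\<close>). Split epimorphisms can be replaced by isomorphisms: if
  \<open>g\<close> has a section \<open>s\<close>, apply the same condition to \<open>s\<close>; either \<open>s\<close> is a split epimorphism, so that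
  \<open>g\<close> is invertible, or \<open>IBD\<^sub>m\<close> holds at \<open>E\<close> and hence at \<open>E'\<close>. What remains is the recursion
  satisfied by the condition on sequences of maps.\<close>

context small_category
begin

section \<open>Kripke--Joyal semantics\<close>

lemma res_in_sec:
  "is_presheaf C P \<Longrightarrow> f \<in> Ar C \<Longrightarrow> x \<in> sec P (tgt C f) \<Longrightarrow> res P f x \<in> sec P (src C f)"
  by (simp add: is_presheaf_def)

text \<open>The pointwise condition is closed under restriction, since maps compose, and testing it
  on the identity puts its meet with \<open>A\<close> inside \<open>B\<close>; so the largest such
  subobject contains it.\<close>

lemma mem_heyting_imp_iff:
  assumes P: "is_presheaf C P"
  shows "x \<in> heyting_imp C P A B D \<longleftrightarrow> D \<in> Ob C \<and> x \<in> sec P D \<and>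
    (\<forall>f\<in>Ar C. tgt C f = D \<longrightarrow> res P f x \<in> A (src C f) \<longrightarrow> res P f x \<in> B (src C f))"
    (is "_ \<longleftrightarrow> ?R D x")
proof
  assume "x \<in> heyting_imp C P A B D"
  then obtain X where X: "X \<in> Sub C P" "inf X A \<le> B" "x \<in> X D"
    unfolding heyting_imp_def by auto
  then show "?R D x" unfolding Sub_def le_fun_def by fastforce
next
  assume R: "?R D x"
  let ?X = "\<lambda>D. {x. ?R D x}"
  have "?X \<in> Sub C P"
    using P unfolding Sub_def is_presheaf_def
    by (auto simp: src_Ob) (metis cmp_Ar src_cmp tgt_cmp)+
  moreover have "x \<in> B E" if "?R E x" "x \<in> A E" for E x
  proof -
    have "idt C E \<in> Ar C" "tgt C (idt C E) = E" "src C (idt C E) = E" "res P (idt C E) x = x"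
      using that P by (auto simp: idt_Ar src_idt tgt_idt is_presheaf_def)
    with that show ?thesis by metis
  qed
  then have "inf ?X A \<le> B" by (auto simp: le_fun_def)
  ultimately have "?X \<le> heyting_imp C P A B" by (simp add: heyting_imp_adjoint)
  with R show "x \<in> heyting_imp C P A B D" by (auto simp: le_fun_def)
qed

text \<open>Every restriction of \<open>x\<close> has to be tested: the fibre of
  \<open>\<alpha>\<close> over a restriction may contain sections that are not restrictions of
  sections over \<open>x\<close>.\<close>

lemma mem_forall_along_iff:
  assumes Q: "is_presheaf C Q"
  shows "x \<in> forall_along C P Q \<alpha> A D \<longleftrightarrow> D \<in> Ob C \<and> x \<in> sec Q D \<and>
    (\<forall>f\<in>Ar C. tgt C f = D \<longrightarrow>
      (\<forall>y\<in>sec P (src C f). \<alpha> (src C f) y = res Q f x \<longrightarrow> y \<in> A (src C f)))"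
    (is "_ \<longleftrightarrow> ?R D x")
proof
  assume "x \<in> forall_along C P Q \<alpha> A D"
  then obtain X where X: "X \<in> Sub C Q" "pullback C P \<alpha> X \<le> A" "x \<in> X D"
    unfolding forall_along_def by auto
  then show "?R D x" unfolding Sub_def le_fun_def pullback_def using src_Ob by fastforce
next
  assume R: "?R D x"
  let ?X = "\<lambda>D. {x. ?R D x}"
  have "?X \<in> Sub C Q"
    using Q unfolding Sub_def is_presheaf_def
    by (auto simp: src_Ob) (metis cmp_Ar src_cmp tgt_cmp)+
  moreover have "y \<in> A E" if "?R E (\<alpha> E y)" "y \<in> sec P E" for E y
  proof -
    have "idt C E \<in> Ar C" "tgt C (idt C E) = E" "src C (idt C E) = E"
      "res Q (idt C E) (\<alpha> E y) = \<alpha> E y"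
      using that Q by (auto simp: idt_Ar src_idt tgt_idt is_presheaf_def)
    with that show ?thesis by metis
  qed
  then have "pullback C P \<alpha> ?X \<le> A" by (auto simp: le_fun_def pullback_def)
  ultimately have "?X \<le> forall_along C P Q \<alpha> A" by (simp add: forall_along_adjoint)
  with R show "x \<in> forall_along C P Q \<alpha> A D" by (auto simp: le_fun_def)
qed

text \<open>A sieve is maximal once it contains the identity, and the identity lies in the
  restriction of \<open>S\<close> along \<open>f\<close> exactly when \<open>f\<close> lies in
  \<open>S\<close>.\<close>

lemma res_Omega_eq_max_sieve_iff:
  assumes "S \<in> sec (Omega C) (tgt C f)" "f \<in> Ar C"
  shows "res (Omega C) f S = max_sieve C (src C f) \<longleftrightarrow> f \<in> S"
proof
  assume "res (Omega C) f S = max_sieve C (src C f)"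
  moreover have "idt C (src C f) \<in> max_sieve C (src C f)"
    using assms by (simp add: max_sieve_def idt_Ar tgt_idt src_Ob)
  ultimately have "idt C (src C f) \<in> res (Omega C) f S" by simp
  with assms show "f \<in> S" by (simp add: Omega_def cmp_idt_right)
qed (use assms in \<open>auto simp: Omega_def max_sieve_def\<close>)

section \<open>Isomorphisms and split epimorphisms\<close>

definition split_epi :: "'a \<Rightarrow> bool" where
  "split_epi f \<longleftrightarrow> f \<in> Ar C \<and> (\<exists>s\<in>Ar C. src C s = tgt C f \<and> tgt C s = src C f \<and>
     cmp C f s = idt C (tgt C f))"

lemma is_iso_imp_split_epi: "is_iso C f \<Longrightarrow> split_epi f"
  by (auto simp: is_iso_def split_epi_def)

lemma is_iso_idt: "D \<in> Ob C \<Longrightarrow> is_iso C (idt C D)"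
  using cmp_idt_left[of "idt C D"]
  by (auto simp: is_iso_def idt_Ar src_idt tgt_idt intro!: bexI[of _ "idt C D"])

text \<open>The map \<open>s\<close> has the left inverse \<open>f\<close> and a right inverse
  \<open>t\<close>; these agree, so \<open>f\<close> and \<open>s\<close> are mutually
  inverse.\<close>

lemma is_iso_if_section_split_epi:
  assumes f: "f \<in> Ar C" and s: "src C s = tgt C f" "tgt C s = src C f" "cmp C f s = idt C (tgt C f)"
    and "split_epi s"
  shows "is_iso C f" "is_iso C s"
proof -
  obtain t where t: "s \<in> Ar C" "t \<in> Ar C" "src C t = tgt C s" "tgt C t = src C s"
    "cmp C s t = idt C (tgt C s)"
    using assms(5) by (auto simp: split_epi_def)
  have "t = cmp C (cmp C f s) t" using t s cmp_idt_left[of t] by simp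
  also have "\<dots> = cmp C f (cmp C s t)" using t s f by (intro cmp_assoc[symmetric]) auto
  also have "\<dots> = f" using t s cmp_idt_right[OF f] by simp
  finally show "is_iso C f" "is_iso C s" using t s f by (auto simp: is_iso_def)
qed

text \<open>With \<open>j\<close> inverse to \<open>cmp C h f\<close>, the inverse of
  \<open>f\<close> is \<open>cmp C j h\<close>. That it is a right inverse follows from
  \<open>cmp C f j\<close> being the inverse \<open>i\<close> of \<open>h\<close>.\<close>

lemma is_iso_cancel_left:
  assumes h: "is_iso C h" and f: "f \<in> Ar C" "src C h = tgt C f" and hf: "is_iso C (cmp C h f)"
  shows "is_iso C f"
proof -
  have hA: "h \<in> Ar C" using h by (simp add: is_iso_def)
  obtain i where i: "i \<in> Ar C" "src C i = tgt C h" "tgt C i = src C h" "cmp C i h = idt C (src C h)"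
    using h by (auto simp: is_iso_def)
  obtain j where j: "j \<in> Ar C" "src C j = tgt C h" "tgt C j = src C f"
    "cmp C j (cmp C h f) = idt C (src C f)" "cmp C (cmp C h f) j = idt C (tgt C h)"
    using hf f hA by (auto simp: is_iso_def src_cmp tgt_cmp)
  have fj: "cmp C f j = i"
  proof -
    have "cmp C f j = cmp C (cmp C i h) (cmp C f j)"
      using i f j cmp_idt_left[of "cmp C f j"] by (simp add: cmp_Ar tgt_cmp)
    also have "\<dots> = cmp C i (cmp C h (cmp C f j))"
      using i f j hA by (intro cmp_assoc[symmetric]) (auto simp: cmp_Ar tgt_cmp)
    also have "cmp C h (cmp C f j) = cmp C (cmp C h f) j"
      using f j hA by (intro cmp_assoc) auto
    also have "cmp C i \<dots> = i" using i j cmp_idt_right[of i] by simp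
    finally show ?thesis .
  qed
  have "cmp C f (cmp C j h) = idt C (tgt C f)"
    using fj i f j hA by (simp add: cmp_assoc)
  moreover have "cmp C (cmp C j h) f = idt C (src C f)"
    using f j hA by (simp add: cmp_assoc)
  ultimately show ?thesis unfolding is_iso_def
    using f j hA by (auto intro!: bexI[of _ "cmp C j h"] simp: cmp_Ar src_cmp tgt_cmp)
qed

section \<open>Objects into which every sequence of maps contains an isomorphism\<close>

text \<open>The index counts maps, so stage \<open>Suc n\<close> belongs to \<open>IBD n\<close> and
  the empty stage \<open>0\<close> to \<open>IBD_minf\<close>. The recursion is on the map applied
  last.\<close>

fun depth_sieve :: "nat \<Rightarrow> 'o set" where
  "depth_sieve 0 = {}"
| "depth_sieve (Suc m) = {D \<in> Ob C. \<forall>f\<in>Ar C. tgt C f = D \<longrightarrow> is_iso C f \<or> src C f \<in> depth_sieve m}"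

text \<open>Composing with \<open>h\<close> turns a map into \<open>src C h\<close> into a map into
  \<open>tgt C h\<close> with the same source, and \<open>h\<close> can be cancelled from an
  invertible composite.\<close>

lemma depth_sieve_iso:
  assumes "is_iso C h" "tgt C h \<in> depth_sieve m"
  shows "src C h \<in> depth_sieve m"
proof (cases m)
  case (Suc k)
  have h: "h \<in> Ar C" using assms by (simp add: is_iso_def)
  have "is_iso C f \<or> src C f \<in> depth_sieve k" if "f \<in> Ar C" "tgt C f = src C h" for f
    using assms Suc h that is_iso_cancel_left[of h f] cmp_Ar[of f h] src_cmp[of f h] tgt_cmp[of f h]
    by auto
  with Suc h show ?thesis by (simp add: src_Ob)
qed (use assms in simp)

text \<open>The condition at \<open>tgt C h\<close> is applied to \<open>cmp C h l\<close>. The hard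
  case is that this composite is invertible although \<open>l\<close> need not be; then
  \<open>l\<close> has a retraction \<open>?r\<close>, to which the condition at
  \<open>src C l\<close> is applied.\<close>

lemma depth_sieve_src: "h \<in> Ar C \<Longrightarrow> tgt C h \<in> depth_sieve m \<Longrightarrow> src C h \<in> depth_sieve m"
proof (induction m arbitrary: h)
  case (Suc m)
  have "is_iso C l \<or> src C l \<in> depth_sieve m" if l: "l \<in> Ar C" "tgt C l = src C h" for l
  proof (cases "is_iso C (cmp C h l)")
    case False
    then show ?thesis
      using Suc.prems l cmp_Ar[of l h] src_cmp[of l h] tgt_cmp[of l h] by auto
  next
    case True
    then obtain i where i: "i \<in> Ar C" "src C i = tgt C h" "tgt C i = src C l"
      "cmp C i (cmp C h l) = idt C (src C l)"
      using Suc.prems l by (auto simp: is_iso_def src_cmp tgt_cmp)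
    let ?r = "cmp C i h"
    have r: "?r \<in> Ar C" "src C ?r = tgt C l" "tgt C ?r = src C l" "cmp C ?r l = idt C (src C l)"
      using Suc.prems l i by (auto simp: cmp_Ar src_cmp tgt_cmp cmp_assoc)
    \<comment> \<open>The invertible composite \<open>cmp C h l\<close> transports membership from
      \<open>tgt C h\<close> to \<open>src C l\<close>, the target of \<open>?r\<close>.\<close>
    have "src C l \<in> depth_sieve (Suc m)"
      using depth_sieve_iso[OF True, of "Suc m"] Suc.prems l by (simp add: src_cmp tgt_cmp)
    then consider "is_iso C ?r" | "tgt C l \<in> depth_sieve m"
      using r by (metis (mono_tags, lifting) depth_sieve.simps(2) mem_Collect_eq)
    then show ?thesis
    proof cases
      case 1
      have "is_iso C l"
        using is_iso_cancel_left[OF 1, of l] r l is_iso_idt[of "src C l"] by (simp add: src_Ob)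
      then show ?thesis ..
    next
      case 2
      then show ?thesis using Suc.IH l by auto
    qed
  qed
  with Suc.prems show ?case by (auto simp: src_Ob)
qed simp

text \<open>From left to right, closure under sources moves the condition from \<open>D\<close> to
  \<open>src C f\<close>. From right to left, the additional quantifier over \<open>f\<close> allows
  a section of a given map to be tested as well.\<close>

lemma mem_depth_sieve_Suc_iff_split_epi:
  assumes D: "D \<in> Ob C"
  shows "D \<in> depth_sieve (Suc m) \<longleftrightarrow> (\<forall>f\<in>Ar C. tgt C f = D \<longrightarrow>
    (\<forall>g\<in>Ar C. tgt C g = src C f \<longrightarrow> split_epi g \<or> src C g \<in> depth_sieve m))" (is "_ \<longleftrightarrow> ?R")
proof
  assume *: "D \<in> depth_sieve (Suc m)"
  show ?R
  proof (intro ballI impI)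
    fix f g assume fg: "f \<in> Ar C" "tgt C f = D" "g \<in> Ar C" "tgt C g = src C f"
    then have "src C f \<in> depth_sieve (Suc m)" using * depth_sieve_src[of f "Suc m"] by metis
    with fg show "split_epi g \<or> src C g \<in> depth_sieve m" using is_iso_imp_split_epi by auto
  qed
next
  assume R: ?R
  have "is_iso C f \<or> src C f \<in> depth_sieve m" if f: "f \<in> Ar C" "tgt C f = D" for f
  proof -
    have "idt C D \<in> Ar C" "src C (idt C D) = D" "tgt C (idt C D) = D"
      using D by (auto simp: idt_Ar src_idt tgt_idt)
    \<comment> \<open>The instance of \<open>?R\<close> whose first-applied map is \<open>f\<close>,
      followed by the identity of \<open>D\<close>.\<close>
    then consider "split_epi f" | "src C f \<in> depth_sieve m" using R f by metis
    then show ?thesis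
    proof cases
      case 1
      then obtain s where s: "s \<in> Ar C" "src C s = tgt C f" "tgt C s = src C f"
        "cmp C f s = idt C (tgt C f)" by (auto simp: split_epi_def)
      \<comment> \<open>The instance of \<open>?R\<close> whose first-applied map is the section
        \<open>s\<close>, followed by \<open>f\<close>.\<close>
      then have "split_epi s \<or> tgt C f \<in> depth_sieve m" using R f by metis
      then show ?thesis using f s is_iso_if_section_split_epi[of f s] depth_sieve_src[of f m] by auto
    qed simp
  qed
  with D show "D \<in> depth_sieve (Suc m)" by simp
qed

section \<open>From the recursion to sequences of maps\<close>

lemma composable_to_snoc:
  assumes "fs \<noteq> []"
  shows "composable_to C D (fs @ [f]) \<longleftrightarrow> f \<in> Ar C \<and> tgt C f = D \<and> composable_to C (src C f) fs"
proof -
  have "(\<forall>i. Suc i < length (fs @ [f]) \<longrightarrow> tgt C ((fs @ [f]) ! i) = src C ((fs @ [f]) ! Suc i)) \<longleftrightarrow>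
    (\<forall>i. Suc i < length fs \<longrightarrow> tgt C (fs ! i) = src C (fs ! Suc i)) \<and> tgt C (last fs) = src C f"
    (is "?L \<longleftrightarrow> ?R")
  proof
    assume L: ?L
    show ?R
      \<comment> \<open>This index is the junction between \<open>fs\<close> and
        \<open>f\<close>.\<close>
      using L[rule_format, of "length fs - 1"] L assms
      by (auto simp: nth_append last_conv_nth dest: spec)
  next
    assume R: ?R
    show ?L
    proof (intro allI impI)
      fix i assume i: "Suc i < length (fs @ [f])"
      show "tgt C ((fs @ [f]) ! i) = src C ((fs @ [f]) ! Suc i)"
      proof (cases "Suc i < length fs")
        case False
        with i have "i = length fs - 1" "Suc i = length fs" by auto
        with R assms show ?thesis by (simp add: nth_append last_conv_nth)
      qed (use R in \<open>simp add: nth_append\<close>)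
    qed
  qed
  with assms show ?thesis by (auto simp: composable_to_def)
qed

lemma mem_depth_sieve_Suc_iff:
  "D \<in> depth_sieve (Suc m) \<longleftrightarrow> D \<in> Ob C \<and>
    (\<forall>fs. length fs = Suc m \<and> composable_to C D fs \<longrightarrow> (\<exists>f\<in>set fs. is_iso C f))"
proof (induction m arbitrary: D)
  case 0
  have "length fs = Suc 0 \<and> composable_to C D fs \<longleftrightarrow> (\<exists>f\<in>Ar C. tgt C f = D \<and> fs = [f])" for fs
    by (cases fs) (auto simp: composable_to_def)
  then show ?case by auto
next
  case (Suc m)
  have snoc: "composable_to C D (gs @ [f]) \<longleftrightarrow>
      f \<in> Ar C \<and> tgt C f = D \<and> composable_to C (src C f) gs" if "length gs = Suc m" for gs f
    using that by (intro composable_to_snoc) auto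
  have "(\<forall>fs. length fs = Suc (Suc m) \<and> composable_to C D fs \<longrightarrow> (\<exists>f\<in>set fs. is_iso C f)) \<longleftrightarrow>
    (\<forall>gs f. length gs = Suc m \<and> composable_to C D (gs @ [f]) \<longrightarrow> (\<exists>f\<in>set (gs @ [f]). is_iso C f))"
    (is "?all \<longleftrightarrow> _")
    unfolding length_Suc_conv_rev[of _ "Suc m"] by blast
  also have "\<dots> \<longleftrightarrow> (\<forall>f\<in>Ar C. tgt C f = D \<longrightarrow> is_iso C f \<or>
      (\<forall>gs. length gs = Suc m \<and> composable_to C (src C f) gs \<longrightarrow> (\<exists>f\<in>set gs. is_iso C f)))"
    (is "_ \<longleftrightarrow> ?rec")
    using snoc unfolding set_append list.set Un_iff Bex_def by blast
  finally have "?all \<longleftrightarrow> ?rec" .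
  moreover have "D \<in> depth_sieve (Suc (Suc m)) \<longleftrightarrow>
      D \<in> Ob C \<and> (\<forall>f\<in>Ar C. tgt C f = D \<longrightarrow> is_iso C f \<or> src C f \<in> depth_sieve (Suc m))"
    by simp
  ultimately show ?case unfolding Suc.IH using src_Ob by blast
qed

section \<open>Interpretation of the formulas\<close>

text \<open>Over each object the interpretation of \<open>\<phi>\<close> is everything or nothing,
  as for a closed formula; only the quantifier over sieves has to be eliminated.\<close>

lemma interp_IBD_step:
  assumes \<phi>: "\<And>E. E \<in> Ob C \<Longrightarrow>
    interp C (Suc k) \<phi> E = (if E \<in> depth_sieve m then sec (Omega_pow C (Suc k)) E else {})"
    and D: "D \<in> Ob C"
  shows "interp C k (All (Or (Var 0) (Imp (Var 0) \<phi>))) D =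
    (if D \<in> depth_sieve (Suc m) then sec (Omega_pow C k) D else {})"
proof -
  let ?P = "Omega_pow C (Suc k)"
  have Var: "xs \<in> interp C (Suc k) (Var 0) E \<longleftrightarrow> E \<in> Ob C \<and> xs \<in> sec ?P E \<and> hd xs = max_sieve C E"
    for xs E
    by (cases xs) (auto simp: pullback_def truth_def Omega_pow_def)
  have Imp: "xs \<in> interp C (Suc k) (Imp (Var 0) \<phi>) E \<longleftrightarrow>
      (\<forall>g\<in>hd xs. src C g \<in> depth_sieve m)" if E: "E \<in> Ob C" and xs: "xs \<in> sec ?P E" for xs E
  proof -
    obtain S ys where S: "xs = S # ys" "S \<in> sec (Omega C) E"
      using xs by (cases xs) (auto simp: Omega_pow_def)
    have rs: "res ?P g xs \<in> sec ?P (src C g)" if "g \<in> Ar C" "tgt C g = E" for g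
      using res_in_sec[OF is_presheaf_Omega_pow] that xs by metis
    have hd: "hd (res ?P g xs) = max_sieve C (src C g) \<longleftrightarrow> g \<in> S"
      if "g \<in> Ar C" "tgt C g = E" for g
      using that S res_Omega_eq_max_sieve_iff[of S g] by (simp add: Omega_pow_def)
    have "g \<in> Ar C \<and> tgt C g = E" if "g \<in> S" for g
      using S that by (auto simp: Omega_def max_sieve_def)
    then show ?thesis
      unfolding interp.simps(4) mem_heyting_imp_iff[OF is_presheaf_Omega_pow] Var
      using E xs rs hd \<phi> by (auto simp: src_Ob S(1) split: if_splits)
  qed
  \<comment> \<open>The quantifier over sieves reduces to one over maps: a sieve containing a split
    epimorphism is maximal, and the sieve generated by \<open>g\<close> is maximal only if
    \<open>g\<close> splits.\<close>
  have sieve: "(\<forall>S\<in>sec (Omega C) E. S = max_sieve C E \<or> (\<forall>g\<in>S. src C g \<in> depth_sieve m)) \<longleftrightarrow>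
      (\<forall>g\<in>Ar C. tgt C g = E \<longrightarrow> split_epi g \<or> src C g \<in> depth_sieve m)" (is "?L \<longleftrightarrow> ?R")
    if E: "E \<in> Ob C" for E
  proof
    assume L: ?L
    show ?R
    proof (intro ballI impI)
      fix g assume g: "g \<in> Ar C" "tgt C g = E"
      let ?S = "{cmp C g h | h. h \<in> Ar C \<and> tgt C h = src C g}"
      have "?S \<in> sec (Omega C) E"
        using g unfolding Omega_def
        by (auto simp: max_sieve_def cmp_Ar tgt_cmp src_cmp)
          (metis cmp_Ar cmp_assoc tgt_cmp)
      then consider "?S = max_sieve C E" | "\<forall>g\<in>?S. src C g \<in> depth_sieve m"
        using L by meson
      then show "split_epi g \<or> src C g \<in> depth_sieve m"
      proof cases
        case 1
        have "idt C E \<in> ?S" unfolding 1 using E by (simp add: max_sieve_def idt_Ar tgt_idt)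
        then obtain h where h: "h \<in> Ar C" "tgt C h = src C g" "idt C E = cmp C g h" by blast
        then have "src C h = E" using E g src_cmp[of h g] src_idt[of E] by metis
        with h g show ?thesis unfolding split_epi_def by metis
      next
        case 2
        have "cmp C g (idt C (src C g)) \<in> ?S"
          using idt_Ar[of "src C g"] tgt_idt[of "src C g"] src_Ob[OF g(1)] by blast
        then have "g \<in> ?S" by (simp only: cmp_idt_right[OF g(1)])
        with 2 show ?thesis by blast
      qed
    qed
  next
    assume R: ?R
    show ?L
    proof (intro ballI)
      fix S assume S: "S \<in> sec (Omega C) E"
      have "S = max_sieve C E" if g: "g \<in> S" "split_epi g" for g
      proof -
        have gE: "tgt C g = E" using S g by (auto simp: Omega_def max_sieve_def)
        obtain s where "s \<in> Ar C" "tgt C s = src C g" "cmp C g s = idt C E"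
          using g gE by (auto simp: split_epi_def)
        then have "idt C E \<in> S" using S g by (fastforce simp: Omega_def)
        then have "cmp C (idt C E) f \<in> S" if "f \<in> max_sieve C E" for f
          using S that E src_idt[of E] by (auto simp: Omega_def max_sieve_def)
        then have "f \<in> S" if "f \<in> max_sieve C E" for f
          using that cmp_idt_left[of f] unfolding max_sieve_def by (metis (mono_tags) mem_Collect_eq)
        then show ?thesis using S by (auto simp: Omega_def)
      qed
      moreover have "g \<in> Ar C \<and> tgt C g = E" if "g \<in> S" for g
        using S that by (auto simp: Omega_def max_sieve_def)
      ultimately show "S = max_sieve C E \<or> (\<forall>g\<in>S. src C g \<in> depth_sieve m)" using R by blast
    qed
  qed
  have "xs \<in> interp C k (All (Or (Var 0) (Imp (Var 0) \<phi>))) D \<longleftrightarrow>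
      xs \<in> sec (Omega_pow C k) D \<and> D \<in> depth_sieve (Suc m)" for xs
  proof -
    have "(\<forall>y\<in>sec ?P (src C f). tl y = res (Omega_pow C k) f xs \<longrightarrow>
          y \<in> interp C (Suc k) (Or (Var 0) (Imp (Var 0) \<phi>)) (src C f)) \<longleftrightarrow>
        (\<forall>g\<in>Ar C. tgt C g = src C f \<longrightarrow> split_epi g \<or> src C g \<in> depth_sieve m)"
      (is "?L \<longleftrightarrow> ?R") if f: "f \<in> Ar C" "tgt C f = D" and xs: "xs \<in> sec (Omega_pow C k) D" for f
    proof -
      have rs: "res (Omega_pow C k) f xs \<in> sec (Omega_pow C k) (src C f)"
        using res_in_sec[OF is_presheaf_Omega_pow] f xs by metis
      let ?ys = "res (Omega_pow C k) f xs" and ?\<psi> = "Or (Var 0) (Imp (Var 0) \<phi>)"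
      \<comment> \<open>The fibre of the projection over \<open>?ys\<close> is a copy of the set of
        sieves on \<open>src C f\<close>.\<close>
      have pow: "y \<in> sec ?P (src C f) \<and> tl y = ?ys \<longleftrightarrow> (\<exists>S\<in>sec (Omega C) (src C f). y = S # ?ys)"
        for y
        using rs by (cases y) (auto simp: Omega_pow_def)
      have "S # ?ys \<in> interp C (Suc k) ?\<psi> (src C f) \<longleftrightarrow>
          S = max_sieve C (src C f) \<or> (\<forall>g\<in>S. src C g \<in> depth_sieve m)"
        if "S \<in> sec (Omega C) (src C f)" for S
      proof -
        have "S # ?ys \<in> sec ?P (src C f)" using pow that by blast
        then show ?thesis
          using Var[of "S # ?ys" "src C f"] Imp[of "src C f" "S # ?ys"] src_Ob[OF f(1)]
          unfolding interp.simps(3) sup_fun_def Un_iff list.sel(1) by blast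
      qed
      then have "?L \<longleftrightarrow> (\<forall>S\<in>sec (Omega C) (src C f).
          S = max_sieve C (src C f) \<or> (\<forall>g\<in>S. src C g \<in> depth_sieve m))"
        using pow by metis
      also have "\<dots> \<longleftrightarrow> ?R" using f by (intro sieve src_Ob)
      finally show ?thesis .
    qed
    then show ?thesis
      unfolding interp.simps(5) mem_forall_along_iff[OF is_presheaf_Omega_pow]
        mem_depth_sieve_Suc_iff_split_epi[OF D]
      using D by blast
  qed
  then show ?thesis by auto
qed

text \<open>The context length \<open>k\<close> stays arbitrary because each \<open>IBD n\<close> is
  also interpreted under the binder of the next formula.\<close>

lemma interp_IBD:
  "D \<in> Ob C \<Longrightarrow> interp C k (IBD n) D =
    (if D \<in> depth_sieve (Suc n) then sec (Omega_pow C k) D else {})"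
proof (induction n arbitrary: k D)
  case 0
  show ?case unfolding IBD.simps
    by (rule interp_IBD_step) (simp_all add: IBD_minf_def 0)
next
  case (Suc n)
  show ?case unfolding IBD.simps
    by (rule interp_IBD_step) (simp_all add: Suc del: depth_sieve.simps)
qed

end

theorem proposition3p7:
  fixes C :: "('o, 'a) cat" and n :: nat
  assumes "small_category C"
  shows "sieve_of C (interp C 0 (IBD n)) =
    {D \<in> Ob C. \<forall>fs. length fs = n + 1 \<and> composable_to C D fs \<longrightarrow> (\<exists>f\<in>set fs. is_iso C f)}"
proof -
  interpret small_category C by fact
  \<comment> \<open>The empty list is a section over every object, so a nonempty value detects
    membership in the stage.\<close>
  have "sec (Omega_pow C 0) D \<noteq> {}" for D by (simp add: Omega_pow_def)
  then have "sieve_of C (interp C 0 (IBD n)) = {D \<in> Ob C. D \<in> depth_sieve (Suc n)}"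
    using interp_IBD[of _ 0 n] by (auto simp: sieve_of_def simp del: depth_sieve.simps split: if_splits)
  then show ?thesis unfolding mem_depth_sieve_Suc_iff by simp
qed

end
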